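(* Let $X$ be a proper complete metric space, $\Lambda$ a (nonempty) compact metric space, and $w:\Lambda\times X\to X$ a continuous iterated function system. Let $p$ be a fair Borel probability measure on $\Lambda$ and $\mathbb P=p^{\mathbb N}$ the product measure on $\Omega=\Lambda^{\mathbb N}$. Suppose that $w$ has an attractor $A$ with local basin of attraction $U$. Then for every point $x\in U$, $\mathbb P(\mathcal A(x))=1$.
   Context: An iterated function system (IFS) is a continuous map $w:\Lambda\times X\to X$; put $w_\lambda(x):=w(\lambda,x)$. $\mathcal K(X)$ is the family of nonempty compact subsets of $X$, $d_H(A,B)=\sup\{d(a,B),d(b,A):a\in A,b\in B\}$ with $d(x,F)=\inf_{y\in F}d(x,y)$ (the same formula is used for arbitrary nonempty subsets), and $\mathcal F:\mathcal K(X)\to\mathcal K(X)$ is $\mathcal F(A)=\bigcup_{\lambda\in\Lambda}w_\lambda(A)$. $A\in\mathcal K(X)$ is an attractor of $w$ with local basin of attraction $U$ if $U$ is an open neighborhood of $A$ and $\mathcal F^n(B)\to A$ in the Hausdorff metric for every $B\in\mathcal K(X)$ with $B\subset U$. A metric space is proper if every closed ball is compact. A Borel probability measure $p$ on $\Lambda$ is fair if there is a function $f:(0,+\infty)\to(0,1]$ such that $p(B(\lambda,\delta))\ge f(\delta)$ for every $\lambda\in\Lambda$ and every $\delta>0$. For $x\in X$, $\mathcal A(x)\subset\Omega$ is the set of sequences $\{\lambda_k\}_{k=1}^\infty$ such that the corresponding orbit $x_0=x$, $x_k=w_{\lambda_k}(x_{k-1})$ draws the attractor, i.e. $A=\lim_{k\to\infty}\{x_n\}_{n=k}^\infty$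 in the Hausdorff metric, meaning $d_H(A,\{x_n:n\ge k\})\to 0$ as $k\to\infty$. *)

theory Defs
  imports "HOL-Probability.Probability"
begin

definition proper_space :: "'x::metric_space itself \<Rightarrow> bool" where
  "proper_space _ \<longleftrightarrow> (\<forall>(x::'x) r. compact (cball x r))"

definition ifs :: "('l::metric_space \<Rightarrow> 'x::metric_space \<Rightarrow> 'x) \<Rightarrow> bool" where
  "ifs w \<longleftrightarrow> continuous_on UNIV (\<lambda>(l, x). w l x)"

definition nonempty_compacts :: "'x::metric_space set set" where
  "nonempty_compacts = {B. B \<noteq> {} \<and> compact B}"

text \<open>
  The distance takes values in \<^typ>\<open>ennreal\<close> because it is also applied to sets that are
  not known to be bounded (tails of orbits), where the supremum may be infinite.
  It is meaningful for nonempty sets only: \<^const>\<open>infdist\<close> to the empty set is 0.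
\<close>
definition hausdorff_dist :: "'x::metric_space set \<Rightarrow> 'x set \<Rightarrow> ennreal" where
  "hausdorff_dist A B =
     Sup ({ennreal (infdist a B) | a. a \<in> A} \<union> {ennreal (infdist b A) | b. b \<in> B})"

definition hutchinson :: "('l \<Rightarrow> 'x \<Rightarrow> 'x) \<Rightarrow> 'x set \<Rightarrow> 'x set" where
  "hutchinson w B = (\<Union>l. w l ` B)"

definition attractor_with_basin ::
    "('l::metric_space \<Rightarrow> 'x::metric_space \<Rightarrow> 'x) \<Rightarrow> 'x set \<Rightarrow> 'x set \<Rightarrow> bool" where
  "attractor_with_basin w A U \<longleftrightarrow>
     A \<in> nonempty_compacts \<and> open U \<and> A \<subseteq> U \<and>
     (\<forall>B\<in>nonempty_compacts. B \<subseteq> U \<longrightarrow>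
        (\<lambda>n. hausdorff_dist ((hutchinson w ^^ n) B) A) \<longlonglongrightarrow> 0)"

definition fair_measure :: "'l::metric_space measure \<Rightarrow> bool" where
  "fair_measure p \<longleftrightarrow>
     (\<exists>f :: real \<Rightarrow> real. (\<forall>\<delta>>0. 0 < f \<delta> \<and> f \<delta> \<le> 1) \<and>
        (\<forall>l. \<forall>\<delta>>0. f \<delta> \<le> measure p (ball l \<delta>)))"

text \<open>Sequences are indexed from 0, so \<open>\<omega> k\<close> is the symbol
  \<open>\<lambda>\<^sub>k\<^sub>+\<^sub>1\<close> that takes \<open>x\<^sub>k\<close> to \<open>x\<^sub>k\<^sub>+\<^sub>1\<close>.\<close>
primrec orbit :: "('l \<Rightarrow> 'x \<Rightarrow> 'x) \<Rightarrow> 'x \<Rightarrow> (nat \<Rightarrow> 'l) \<Rightarrow> nat \<Rightarrow> 'x" where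
  "orbit w x \<omega> 0 = x"
| "orbit w x \<omega> (Suc k) = w (\<omega> k) (orbit w x \<omega> k)"

definition drawing_sequences ::
    "('l \<Rightarrow> 'x::metric_space \<Rightarrow> 'x) \<Rightarrow> 'x set \<Rightarrow> 'x \<Rightarrow> (nat \<Rightarrow> 'l) set" where
  "drawing_sequences w A x =
     {\<omega>. (\<lambda>k. hausdorff_dist A {orbit w x \<omega> n | n. n \<ge> k}) \<longlonglongrightarrow> 0}"

end

theory Submission
  imports Defs
begin

text \<open>
  An orbit draws \<open>A\<close> iff it approaches \<open>A\<close> and comes back infinitely often to every
  ball around a point of \<open>A\<close>.

  Approaching \<open>A\<close> is not random: the points that orbits of \<open>x\<close> can reach after
  \<open>n\<close> steps form exactly the set \<open>(hutchinson w ^^ n) {x}\<close>, which converges to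
  \<open>A\<close> (\<open>basin_hausdorff\<close>). So from some time on all orbits of \<open>x\<close> live in
  one compact neighbourhood \<open>K \<subseteq> U\<close> of \<open>A\<close>; this is where properness is used
  (\<open>attractor_compact_neighbourhood\<close>).

  Recurrence rests on a geometric bound for the probability of avoidance. Let \<open>V\<close> be a ball around
  a point of \<open>A\<close>. From each \<open>y \<in> K\<close> some finite word leads into \<open>V\<close>,
  and by continuity so do all nearby words from all nearby starting points. Fairness gives nearby words positive
  probability, and compactness of \<open>K\<close> makes the bounds uniform: from every point of
  \<open>K\<close> the orbit hits \<open>V\<close> within \<open>L\<close> steps with probability at least
  \<open>c > 0\<close> (\<open>uniform_hitting_bound\<close>). By independence of successive blocks of
  \<open>L\<close> symbols, \<open>V\<close> is avoided during \<open>j\<close> blocks with probability at most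
  \<open>(1 - c)\<^sup>j\<close>, so it is hit infinitely often almost surely
  (\<open>AE_infinitely_often_hits\<close>). Finite nets of \<open>A\<close> reduce the statement to countably
  many balls \<open>V\<close>.

  The measure of a set that is not measurable is \<open>0\<close> by convention, so measurability of the set of
  drawing sequences is part of the claim. It rests on \<open>open_in_sets_PiM\<close>.
\<close>

section \<open>Orbits\<close>

lemma orbit_comb_seq_le:
  "n \<le> t \<Longrightarrow> orbit w x (comb_seq t \<omega> \<omega>') n = orbit w x \<omega> n"
  by (induction n) (auto simp: comb_seq_def)

text \<open>The Markov property in deterministic form: after time \<open>t\<close> the orbit restarts at the point
  reached, driven by the remaining symbols.\<close>

lemma orbit_comb_seq_add:
  "orbit w x (comb_seq t \<omega> \<omega>') (t + n) = orbit w (orbit w x \<omega> t) \<omega>' n"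
  by (induction n) (simp_all add: orbit_comb_seq_le, simp add: comb_seq_def)

text \<open>This turns convergence of the iterates of the Hutchinson operator into statements that are
  uniform in the driving sequence.\<close>

lemma hutchinson_funpow_singleton:
  "(hutchinson w ^^ n) {y} = {orbit w y \<omega> n | \<omega>. True}"
proof (induction n)
  case 0
  show ?case by simp
next
  case (Suc n)
  have "w l (orbit w y \<omega> n) = orbit w y (comb_seq n \<omega> (\<lambda>_. l)) (Suc n)" for l \<omega>
    by (simp add: orbit_comb_seq_le) (simp add: comb_seq_def)
  then have "\<exists>\<omega>'. w l (orbit w y \<omega> n) = orbit w y \<omega>' (Suc n)" for l \<omega>
    by blast
  then have "hutchinson w {orbit w y \<omega> n | \<omega>. True} = {orbit w y \<omega> (Suc n) | \<omega>. True}"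
    unfolding hutchinson_def by (auto simp del: orbit.simps) (auto simp: image_iff)
  then show ?case by (simp add: Suc)
qed

text \<open>Continuity jointly in the starting point and the driving sequence (in the product topology)
  is what allows a hitting word to be perturbed together with its starting point.\<close>

lemma continuous_orbit:
  fixes w :: "'l::metric_space \<Rightarrow> 'x::metric_space \<Rightarrow> 'x"
  assumes "ifs w"
  shows "continuous_on UNIV (\<lambda>(y, \<omega>). orbit w y \<omega> n)"
proof (induction n)
  case 0
  show ?case by (simp add: case_prod_beta continuous_on_fst continuous_on_id)
next
  case (Suc n)
  have c: "continuous_on UNIV (\<lambda>q :: 'x \<times> (nat \<Rightarrow> 'l). snd q n)"
    by (rule continuous_on_compose2[OF continuous_on_product_coordinates
          continuous_on_snd[OF continuous_on_id]]) auto
  have "continuous_on UNIV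
      (\<lambda>q. (\<lambda>(l, x). w l x) (snd q n, (\<lambda>(y, \<omega>). orbit w y \<omega> n) q))"
    by (rule continuous_on_compose2[OF assms[unfolded ifs_def] continuous_on_Pair[OF c Suc]]) auto
  then show ?case by (simp add: case_prod_beta)
qed

lemma continuous_orbit_sequence:
  fixes w :: "'l::metric_space \<Rightarrow> 'x::metric_space \<Rightarrow> 'x"
  assumes "ifs w"
  shows "continuous_on UNIV (\<lambda>\<omega>. orbit w y \<omega> n)"
  using continuous_on_compose2[OF continuous_orbit[OF assms, of n]
      continuous_on_Pair[OF continuous_on_const continuous_on_id, of UNIV y]]
  by simp

section \<open>Open sets of sequences\<close>

lemma open_sequences_contains_box:
  fixes W :: "(nat \<Rightarrow> 'l::topological_space) set"
  assumes "open W" "\<omega> \<in> W"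
  obtains X where "\<And>i. open (X i)" "finite {i. X i \<noteq> UNIV}"
    "\<omega> \<in> Pi\<^sub>E UNIV X" "Pi\<^sub>E UNIV X \<subseteq> W"
proof -
  have "openin (product_topology (\<lambda>i. euclidean) UNIV) W"
    using assms(1) by (simp add: open_fun_def)
  from product_topology_open_contains_basis[OF this assms(2)]
  obtain X where X: "\<omega> \<in> (\<Pi>\<^sub>E i\<in>UNIV. X i)" "\<And>i. open (X i)" "finite {i. X i \<noteq> UNIV}"
    "(\<Pi>\<^sub>E i\<in>UNIV. X i) \<subseteq> W"
    by auto
  show thesis
    by (rule that[of X]) (use X in auto)
qed

text \<open>
  The alphabet is separable only as a consequence of compactness, not by its type class, so the
  countability needed here is drawn from compactness: an open set of sequences is the union of
  countably many compact sets \<open>C n\<close> (the points at distance at least \<open>1 / (n + 1)\<close> from the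
  complement), and each of them is covered by finitely many open boxes inside the open set.
\<close>

lemma open_in_sets_PiM:
  fixes p :: "'l::metric_space measure" and W :: "(nat \<Rightarrow> 'l) set"
  assumes "compact (UNIV :: 'l set)" and "sets p = sets borel" and "open W"
  shows "W \<in> sets (\<Pi>\<^sub>M k\<in>(UNIV :: nat set). p)"
  \<comment> \<open>The whole space is treated apart because \<^const>\<open>infdist\<close> to the empty set is 0.\<close>
proof (cases "W = UNIV")
  case True
  have "space p = UNIV" using sets_eq_imp_space_eq[OF assms(2)] by simp
  then have "W = space (\<Pi>\<^sub>M k\<in>(UNIV :: nat set). p)"
    using True by (simp add: space_PiM PiE_UNIV_domain)
  then show ?thesis by (metis sets.top)
next
  case False
  let ?S = "\<Pi>\<^sub>M k\<in>(UNIV :: nat set). p"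
  have comp: "compact (UNIV :: (nat \<Rightarrow> 'l) set)"
  proof -
    have "compact_space (product_topology (\<lambda>i::nat. euclidean :: 'l topology) UNIV)"
      using assms(1) by (subst compact_space_product_topology) (simp add: compact_space_def)
    then show ?thesis
      by (simp add: euclidean_product_topology compact_space_def)
  qed
  define C where "C n = {\<omega>. 1 / real (Suc n) \<le> infdist \<omega> (- W)}" for n
  have "compact (C n)" for n
  proof -
    have "closed (C n)"
      unfolding C_def by (intro closed_Collect_le continuous_intros)
    then show ?thesis using comp by (metis compact_Int_closed Int_UNIV_left)
  qed
  \<comment> \<open>Points of \<open>W\<close> have positive distance to the closed set \<open>- W\<close>.\<close>
  have W_eq: "W = (\<Union>n. C n)"
  proof (intro equalityI subsetI)
    fix \<omega> assume "\<omega> \<in> W"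
    then have "0 < infdist \<omega> (- W)"
      using False assms(3) by (intro infdist_pos_not_in_closed) (auto simp: closed_Compl)
    from reals_Archimedean[OF this] obtain n where "inverse (real (Suc n)) < infdist \<omega> (- W)" ..
    then show "\<omega> \<in> (\<Union>n. C n)" by (auto simp: C_def field_simps intro!: exI[of _ n])
  next
    fix \<omega> assume "\<omega> \<in> (\<Union>n. C n)"
    then obtain n where n: "1 / real (Suc n) \<le> infdist \<omega> (- W)" by (auto simp: C_def)
    show "\<omega> \<in> W"
    proof (rule ccontr)
      assume "\<omega> \<notin> W"
      then have "infdist \<omega> (- W) = 0" by simp
      with n show False by (simp add: field_simps)
    qed
  qed
  have "\<exists>B. B \<in> sets ?S \<and> C n \<subseteq> B \<and> B \<subseteq> W" for n
  proof -
    define \<B> where "\<B> = {b \<in> sets ?S. open b \<and> b \<subseteq> W}"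
    have op: "open b" if "b \<in> \<B>" for b
      using that by (simp add: \<B>_def)
    have "C n \<subseteq> \<Union>\<B>"
    proof
      fix \<omega> assume "\<omega> \<in> C n"
      then have "\<omega> \<in> W" using W_eq by blast
      then obtain X where X: "\<And>i. open (X i)" "finite {i. X i \<noteq> UNIV}"
        "\<omega> \<in> Pi\<^sub>E UNIV X" "Pi\<^sub>E UNIV X \<subseteq> W"
        using open_sequences_contains_box[OF assms(3)] by metis
      have "Pi\<^sub>E UNIV X \<in> sets ?S"
        using X(1) assms(2) by (intro sets_PiM_I_countable) auto
      then have "Pi\<^sub>E UNIV X \<in> \<B>"
        using open_PiE[of X, OF X(1,2)] X(4) by (simp add: \<B>_def)
      then show "\<omega> \<in> \<Union>\<B>" using X(3) by blast
    qed
    from compactE[OF \<open>compact (C n)\<close> this op]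
    obtain D where D: "D \<subseteq> \<B>" "finite D" "C n \<subseteq> \<Union>D" by metis
    have "\<Union>D \<in> sets ?S" using D by (intro sets.finite_Union) (auto simp: \<B>_def)
    moreover have "\<Union>D \<subseteq> W" using D(1) by (auto simp: \<B>_def)
    ultimately show ?thesis using D(3) by blast
  qed
  then obtain B where B: "\<And>n. B n \<in> sets ?S" "\<And>n. C n \<subseteq> B n" "\<And>n. B n \<subseteq> W"
    by metis
  then have "W = (\<Union>n. B n)" using W_eq by blast
  also have "\<dots> \<in> sets ?S" using B by (intro sets.countable_UN) auto
  finally show ?thesis .
qed

lemma continuous_imp_measurable_PiM:
  fixes p :: "'l::metric_space measure" and g :: "(nat \<Rightarrow> 'l) \<Rightarrow> 'b::topological_space"
  assumes "compact (UNIV :: 'l set)" and "sets p = sets borel" and "continuous_on UNIV g"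
  shows "g \<in> borel_measurable (\<Pi>\<^sub>M k\<in>(UNIV :: nat set). p)"
proof (rule borel_measurableI)
  fix V :: "'b set" assume "open V"
  then have "open (g -` V)"
    using assms(3) by (simp add: continuous_on_open_vimage[OF open_UNIV])
  from open_in_sets_PiM[OF assms(1,2) this]
  show "g -` V \<inter> space (\<Pi>\<^sub>M k\<in>(UNIV :: nat set). p) \<in> sets (\<Pi>\<^sub>M k\<in>(UNIV :: nat set). p)"
    by auto
qed

lemma fair_open_pos:
  assumes "fair_measure p" "finite_measure p" "sets p = sets borel" "open V" "V \<noteq> {}"
  shows "0 < measure p V"
proof -
  obtain l where "l \<in> V" using assms(5) by blast
  then obtain \<delta> where \<delta>: "0 < \<delta>" "ball l \<delta> \<subseteq> V" using assms(4) by (meson openE)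
  have "0 < measure p (ball l \<delta>)"
    using assms(1) \<delta>(1) by (auto simp: fair_measure_def) (meson less_le_trans)
  also have "\<dots> \<le> measure p V"
    using assms \<delta>(2) by (intro finite_measure.finite_measure_mono) auto
  finally show ?thesis .
qed

text \<open>Fairness gives every ball positive mass, hence full support to \<open>p\<close>; a basic box constrains
  only finitely many coordinates, so the product measure inherits full support.\<close>

lemma open_pos_PiM:
  fixes p :: "'l::metric_space measure" and W :: "(nat \<Rightarrow> 'l) set"
  assumes "compact (UNIV :: 'l set)" "sets p = sets borel" "prob_space p" "fair_measure p"
    and "open W" "W \<noteq> {}"
  shows "0 < measure (\<Pi>\<^sub>M k\<in>(UNIV :: nat set). p) W"
proof -
  interpret prob_space p by fact
  interpret sequence_space p by unfold_locales
  have sp: "space p = UNIV" using sets_eq_imp_space_eq[OF assms(2)] by simp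
  obtain X where X: "\<And>i. open (X i)" "finite {i. X i \<noteq> UNIV}" "Pi\<^sub>E UNIV X \<noteq> {}" "Pi\<^sub>E UNIV X \<subseteq> W"
    using assms(5,6) open_sequences_contains_box by (metis all_not_in_conv empty_iff)
  let ?J = "{i. X i \<noteq> UNIV}"
  have box: "Pi\<^sub>E UNIV X = prod_emb UNIV (\<lambda>_. p) ?J (Pi\<^sub>E ?J X)"
    by (fastforce simp: prod_emb_def sp Pi_iff PiE_def)
  have "0 < (\<Prod>i\<in>?J. measure p (X i))"
  proof (intro prod_pos ballI fair_open_pos[OF assms(4) prob_space.axioms(1)[OF assms(3)] assms(2)] X(1))
    fix i show "X i \<noteq> {}" using X(3) by (auto simp: Pi_iff)
  qed
  also have "\<dots> = measure S (Pi\<^sub>E UNIV X)"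
    unfolding box using X assms(2) by (intro measure_PiM_emb[symmetric]) auto
  also have "\<dots> \<le> measure S W"
    using X(4) open_in_sets_PiM[OF assms(1,2,5)] by (intro P.finite_measure_mono) auto
  finally show ?thesis .
qed

section \<open>Hausdorff convergence and drawing sequences\<close>

lemma infdist_less_imp_close_point:
  assumes "infdist a T < e" "T \<noteq> {}"
  shows "\<exists>b\<in>T. dist a b < e"
proof -
  have "(INF b\<in>T. dist a b) < e" using assms by (simp add: infdist_notempty)
  then show ?thesis by (rule cInf_lessD[rotated, THEN bexE]) (use assms(2) in auto)
qed

lemma hausdorff_dist_le_iff:
  assumes "0 \<le> e"
  shows "hausdorff_dist A B \<le> ennreal e \<longleftrightarrow>
    (\<forall>a\<in>A. infdist a B \<le> e) \<and> (\<forall>b\<in>B. infdist b A \<le> e)"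
proof -
  have "{ennreal (infdist a B) | a. a \<in> A} = (\<lambda>a. ennreal (infdist a B)) ` A" for A B :: "'a set"
    by auto
  then show ?thesis
    using assms by (simp add: hausdorff_dist_def Sup_le_iff ball_Un ennreal_le_iff)
qed

lemma hausdorff_dist_commute: "hausdorff_dist A B = hausdorff_dist B A"
  by (simp add: hausdorff_dist_def Un_commute)

lemma tendsto_hausdorff_dist_0_iff:
  "(\<lambda>k. hausdorff_dist (C k) A) \<longlonglongrightarrow> 0 \<longleftrightarrow>
    (\<forall>e>0. \<forall>\<^sub>F k in sequentially. (\<forall>a\<in>A. infdist a (C k) \<le> e) \<and> (\<forall>b\<in>C k. infdist b A \<le> e))"
    (is "?L \<longleftrightarrow> ?R")
proof
  assume L: ?L
  show ?R
  proof (intro allI impI)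
    fix e :: real assume "0 < e"
    then have "\<forall>\<^sub>F k in sequentially. hausdorff_dist (C k) A < ennreal e"
      using L by (intro order_tendstoD) auto
    then show "\<forall>\<^sub>F k in sequentially. (\<forall>a\<in>A. infdist a (C k) \<le> e) \<and> (\<forall>b\<in>C k. infdist b A \<le> e)"
      by eventually_elim (use \<open>0 < e\<close> in \<open>auto dest!: less_imp_le simp: hausdorff_dist_le_iff\<close>)
  qed
next
  assume R: ?R
  show ?L
  proof (rule order_tendstoI)
    fix u :: ennreal assume "0 < u"
    then obtain v where v: "0 < v" "v < u" using dense by blast
    then obtain e where e: "v = ennreal e" "0 < e"
      by (cases v) (auto simp: ennreal_less_zero_iff less_top[symmetric] top_unique)
    have "\<forall>\<^sub>F k in sequentially. hausdorff_dist (C k) A \<le> ennreal e"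
      using R[rule_format, OF e(2)]
      by eventually_elim (use e in \<open>auto simp: hausdorff_dist_le_iff\<close>)
    then show "\<forall>\<^sub>F k in sequentially. hausdorff_dist (C k) A < u"
      by eventually_elim (use v e in \<open>auto intro: le_less_trans\<close>)
  qed auto
qed

text \<open>
  Once all orbits approach \<open>A\<close>, only the other half of the Hausdorff distance matters: tails of
  the orbit must come close to every point of \<open>A\<close>. By the triangle inequality it suffices to
  come close to the points of a net at each scale, which makes the condition countable.
\<close>

lemma drawing_sequences_eq:
  assumes conv: "\<And>e. e > 0 \<Longrightarrow> \<forall>\<^sub>F n in sequentially. \<forall>\<omega>. infdist (orbit w x \<omega> n) A \<le> e"
    and net: "\<And>m. N m \<subseteq> A" "\<And>m. A \<subseteq> (\<Union>a\<in>N m. ball a (1 / real (Suc m)))"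
  shows "drawing_sequences w A x =
    {\<omega>. \<forall>m. \<forall>a\<in>N m. \<forall>k. \<exists>n\<ge>k. orbit w x \<omega> n \<in> ball a (1 / real (Suc m))}" (is "_ = ?R")
proof (intro equalityI subsetI)
  fix \<omega> assume "\<omega> \<in> drawing_sequences w A x"
  then have lim: "(\<lambda>k. hausdorff_dist {orbit w x \<omega> n | n. n \<ge> k} A) \<longlonglongrightarrow> 0"
    by (simp add: drawing_sequences_def hausdorff_dist_commute)
  show "\<omega> \<in> ?R"
  proof (intro CollectI allI ballI)
    fix m a k assume a: "a \<in> N m"
    let ?e = "1 / real (Suc m)"
    have "\<forall>\<^sub>F k in sequentially. \<forall>a\<in>A. infdist a {orbit w x \<omega> n | n. n \<ge> k} \<le> ?e / 2"
      by (rule eventually_mono[OF lim[unfolded tendsto_hausdorff_dist_0_iff, rule_format, of "?e / 2"]])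
        auto
    then obtain k0 where k0: "\<And>k. k \<ge> k0 \<Longrightarrow> infdist a {orbit w x \<omega> n | n. n \<ge> k} \<le> ?e / 2"
      using a net(1) unfolding eventually_sequentially by blast
    \<comment> \<open>Passing to a tail beyond both \<open>k\<close> and \<open>k0\<close> yields a visit after time \<open>k\<close>.\<close>
    define T where "T = {orbit w x \<omega> n | n. n \<ge> max k k0}"
    have "orbit w x \<omega> (max k k0) \<in> T" unfolding T_def by blast
    then have "T \<noteq> {}" by blast
    moreover have "infdist a T < ?e"
      using k0[of "max k k0"] by (simp add: T_def field_simps)
    ultimately obtain b where "b \<in> T" "dist a b < ?e"
      using infdist_less_imp_close_point by blast
    then show "\<exists>n\<ge>k. orbit w x \<omega> n \<in> ball a ?e" by (auto simp: T_def)
  qed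
next
  fix \<omega> assume \<omega>: "\<omega> \<in> ?R"
  have "(\<lambda>k. hausdorff_dist {orbit w x \<omega> n | n. n \<ge> k} A) \<longlonglongrightarrow> 0"
    unfolding tendsto_hausdorff_dist_0_iff
  proof (intro allI impI)
    fix e :: real assume "0 < e"
    then obtain m where m: "1 / real (Suc m) < e / 2"
      using reals_Archimedean[of "e / 2"] by (auto simp: inverse_eq_divide)
    have 1: "infdist a {orbit w x \<omega> n | n. n \<ge> k} \<le> e" if "a \<in> A" for a k
    proof -
      obtain b where b: "b \<in> N m" "dist b a < 1 / real (Suc m)"
        using net(2)[of m] \<open>a \<in> A\<close> by auto
      then obtain n where n: "n \<ge> k" "dist b (orbit w x \<omega> n) < 1 / real (Suc m)"
        using \<omega> unfolding mem_ball by blast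
      have "infdist a {orbit w x \<omega> n | n. n \<ge> k} \<le> dist a (orbit w x \<omega> n)"
        using n by (intro infdist_le) auto
      also have "\<dots> \<le> dist b a + dist b (orbit w x \<omega> n)"
        by (metis dist_commute dist_triangle)
      finally show ?thesis using b n m by linarith
    qed
    have 2: "\<forall>\<^sub>F k in sequentially. \<forall>b\<in>{orbit w x \<omega> n | n. n \<ge> k}. infdist b A \<le> e"
    proof -
      obtain k0 where "\<And>n. n \<ge> k0 \<Longrightarrow> infdist (orbit w x \<omega> n) A \<le> e"
        using conv[OF \<open>0 < e\<close>] unfolding eventually_sequentially by blast
      then show ?thesis unfolding eventually_sequentially by (intro exI[of _ k0]) auto
    qed
    show "\<forall>\<^sub>F k in sequentially. (\<forall>a\<in>A. infdist a {orbit w x \<omega> n | n. n \<ge> k} \<le> e) \<and>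
        (\<forall>b\<in>{orbit w x \<omega> n | n. n \<ge> k}. infdist b A \<le> e)"
      using 2 by (rule eventually_mono) (use 1 in auto)
  qed
  then show "\<omega> \<in> drawing_sequences w A x"
    by (simp add: drawing_sequences_def hausdorff_dist_commute)
qed

section \<open>Behaviour of orbits in the basin\<close>

lemma basin_hausdorff:
  assumes "attractor_with_basin w A U" "y \<in> U" "0 < e"
  shows "\<forall>\<^sub>F n in sequentially. (\<forall>a\<in>A. infdist a {orbit w y \<omega> n | \<omega>. True} \<le> e) \<and>
    (\<forall>\<omega>. infdist (orbit w y \<omega> n) A \<le> e)"
proof -
  have "(\<lambda>n. hausdorff_dist ((hutchinson w ^^ n) {y}) A) \<longlonglongrightarrow> 0"
    using assms by (auto simp: attractor_with_basin_def nonempty_compacts_def)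
  from this[unfolded tendsto_hausdorff_dist_0_iff, rule_format, OF assms(3)]
  show ?thesis
    by (rule eventually_mono) (auto simp: hutchinson_funpow_singleton)
qed

lemma basin_hits_ball:
  assumes "attractor_with_basin w A U" "y \<in> U" "a \<in> A" "0 < e"
  obtains \<omega> n where "orbit w y \<omega> n \<in> ball a e"
proof -
  have "\<forall>\<^sub>F n in sequentially. infdist a {orbit w y \<omega> n | \<omega>. True} \<le> e / 2"
    using basin_hausdorff[OF assms(1,2), of "e / 2"] assms(3,4)
    by (auto elim: eventually_mono)
  then obtain n where "infdist a {orbit w y \<omega> n | \<omega>. True} \<le> e / 2"
    using eventually_happens' sequentially_bot by blast
  then have "infdist a {orbit w y \<omega> n | \<omega>. True} < e" using assms(4) by simp
  then obtain b where "b \<in> {orbit w y \<omega> n | \<omega>. True}" "dist a b < e"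
    using infdist_less_imp_close_point by blast
  then show thesis using that by auto
qed

lemma attractor_compact_neighbourhood:
  assumes "proper_space TYPE('x::metric_space)" "attractor_with_basin w (A :: 'x set) U"
  obtains r where "0 < r" "compact {y. infdist y A \<le> r}" "{y. infdist y A \<le> r} \<subseteq> U"
proof -
  have A: "compact A" "A \<noteq> {}" "open U" "A \<subseteq> U"
    using assms(2) by (auto simp: attractor_with_basin_def nonempty_compacts_def)
  obtain e where e: "0 < e" "(\<Union>a\<in>A. ball a e) \<subseteq> U"
    using compact_subset_open_imp_ball_epsilon_subset[OF A(1,3,4)] by metis
  have near: "\<exists>a\<in>A. dist a y < e" if "infdist y A \<le> e / 2" for y
  proof -
    have "infdist y A < e" using that e(1) by linarith
    from infdist_less_imp_close_point[OF this A(2)] show ?thesis by (simp add: dist_commute)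
  qed
  let ?K = "{y. infdist y A \<le> e / 2}"
  obtain z s where s: "A \<subseteq> cball z s"
    using compact_imp_bounded[OF A(1)] by (meson bounded_subset_cball)
  have "?K \<subseteq> cball z (s + e)"
  proof
    fix y assume "y \<in> ?K"
    then obtain a where "a \<in> A" "dist a y < e" using near by auto
    then show "y \<in> cball z (s + e)"
      using s dist_triangle[of z y a] by (force simp: subset_iff)
  qed
  moreover have "closed ?K" by (intro closed_Collect_le continuous_intros)
  moreover have "compact (cball z (s + e))" using assms(1) by (auto simp: proper_space_def)
  ultimately have "compact ?K" by (metis compact_Int_closed inf.absorb_iff2)
  moreover have "?K \<subseteq> U"
    using near e(2) by (force simp: subset_iff)
  ultimately show thesis using e(1) by (intro that[of "e / 2"]) auto
qed

section \<open>Recurrence\<close>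

text \<open>
  If \<open>\<omega>\<close> leads \<open>y\<close> into the open set \<open>V\<close> in \<open>n\<close> steps, continuity of the orbit gives open
  neighbourhoods \<open>Y\<close> of \<open>y\<close> and \<open>W\<close> of \<open>\<omega>\<close> such that every sequence in \<open>W\<close> leads every point
  of \<open>Y\<close> into \<open>V\<close> in \<open>n\<close> steps, and \<open>W\<close> has positive probability. Finitely many of the \<open>Y\<close>
  cover \<open>K\<close>; the least probability and the greatest number of steps serve for all of \<open>K\<close>.
\<close>

lemma uniform_hitting_bound:
  fixes w :: "'l::metric_space \<Rightarrow> 'x::metric_space \<Rightarrow> 'x" and p :: "'l measure"
  assumes \<Lambda>: "compact (UNIV :: 'l set)" and w: "ifs w"
    and p: "sets p = sets borel" "prob_space p" "fair_measure p"
    and K: "compact K" and V: "open V"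
    and hit: "\<And>y. y \<in> K \<Longrightarrow> \<exists>\<omega> n. orbit w y \<omega> n \<in> V"
  obtains c L where "0 < c" "c \<le> 1"
    "\<And>y. y \<in> K \<Longrightarrow> c \<le> measure (\<Pi>\<^sub>M k\<in>(UNIV :: nat set). p) {\<omega>. \<exists>n<L. orbit w y \<omega> n \<in> V}"
proof -
  interpret prob_space p by fact
  interpret sequence_space p by unfold_locales
  have "\<exists>n Y W. open Y \<and> y \<in> Y \<and> open W \<and> W \<noteq> {} \<and> (\<forall>z\<in>Y. \<forall>\<omega>\<in>W. orbit w z \<omega> n \<in> V)"
    if "y \<in> K" for y
  proof -
    obtain \<omega> n where \<omega>: "orbit w y \<omega> n \<in> V" using hit \<open>y \<in> K\<close> by blast
    have "open ((\<lambda>(z, \<omega>). orbit w z \<omega> n) -` V)"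
      using continuous_orbit[OF w, of n] V by (simp add: continuous_on_open_vimage[OF open_UNIV])
    moreover have "(y, \<omega>) \<in> (\<lambda>(z, \<omega>). orbit w z \<omega> n) -` V" using \<omega> by simp
    ultimately obtain Y W where "open Y" "open W" "(y, \<omega>) \<in> Y \<times> W"
      "Y \<times> W \<subseteq> (\<lambda>(z, \<omega>). orbit w z \<omega> n) -` V"
      by (rule open_prod_elim)
    then show ?thesis by (intro exI[of _ n] exI[of _ Y] exI[of _ W]) auto
  qed
  then obtain n Y W where choice: "\<forall>y\<in>K. open (Y y) \<and> y \<in> Y y \<and> open (W y) \<and> W y \<noteq> {} \<and>
      (\<forall>z\<in>Y y. \<forall>\<omega>\<in>W y. orbit w z \<omega> (n y) \<in> V)"
    by metis
  then have nYW: "\<And>y. y \<in> K \<Longrightarrow> open (Y y)" "\<And>y. y \<in> K \<Longrightarrow> y \<in> Y y"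
    "\<And>y. y \<in> K \<Longrightarrow> open (W y)" "\<And>y. y \<in> K \<Longrightarrow> W y \<noteq> {}"
    "\<And>y z \<omega>. y \<in> K \<Longrightarrow> z \<in> Y y \<Longrightarrow> \<omega> \<in> W y \<Longrightarrow> orbit w z \<omega> (n y) \<in> V"
    by blast+
  obtain F where F: "F \<subseteq> K" "finite F" "K \<subseteq> (\<Union>y\<in>F. Y y)"
    by (rule compactE_image[OF K, of K Y]) (use nYW in blast)+
  \<comment> \<open>Inserting 1 and 0 keeps the minimum and the maximum meaningful when \<open>F\<close> is empty.\<close>
  define c where "c = Min (insert 1 ((\<lambda>y. measure S (W y)) ` F))"
  define L where "L = Suc (Max (insert 0 (n ` F)))"
  show thesis
  proof (rule that[of c L])
    show "0 < c" unfolding c_def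
      using F nYW open_pos_PiM[OF \<Lambda> p] by (subst Min_gr_iff) auto
    show "c \<le> 1" unfolding c_def using F by (intro Min_le) auto
    fix z assume "z \<in> K"
    then obtain y where y: "y \<in> F" "z \<in> Y y" using F(3) by auto
    have "c \<le> measure S (W y)" unfolding c_def using F(2) y by (intro Min_le) auto
    also have "\<dots> \<le> measure S {\<omega>. \<exists>n<L. orbit w z \<omega> n \<in> V}"
    proof (rule P.finite_measure_mono)
      have "n y < L" unfolding L_def using F(2) y by (auto simp: less_Suc_eq_le intro!: Max_ge)
      then show "W y \<subseteq> {\<omega>. \<exists>n<L. orbit w z \<omega> n \<in> V}"
        using nYW(5)[of y z] y F(1) by blast
      have "{\<omega>. \<exists>n<L. orbit w z \<omega> n \<in> V} = (\<Union>n\<in>{..<L}. (\<lambda>\<omega>. orbit w z \<omega> n) -` V)" by auto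
      moreover have "open \<dots>"
        using continuous_orbit_sequence[OF w] V
        by (intro open_UN ballI) (simp add: continuous_on_open_vimage[OF open_UNIV])
      ultimately show "{\<omega>. \<exists>n<L. orbit w z \<omega> n \<in> V} \<in> sets S"
        using open_in_sets_PiM[OF \<Lambda> p(1)] by simp
    qed
    finally show "c \<le> measure S {\<omega>. \<exists>n<L. orbit w z \<omega> n \<in> V}" .
  qed
qed

text \<open>
  Splitting a random sequence at time \<open>t\<close> into two independent random sequences (\<open>PiM_comb_seq\<close>)
  and integrating over the first one shows that avoiding \<open>V\<close> for \<open>L\<close> more steps costs a factor
  \<open>1 - c\<close>: the past determines the point of \<open>K\<close> reached at time \<open>t\<close>, and from there the
  fresh sequence hits \<open>V\<close> within \<open>L\<close> steps with probability at least \<open>c\<close>.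
\<close>

lemma (in sequence_space) AE_infinitely_often_hits:
  assumes meas: "\<And>y n. {\<omega>. orbit w y \<omega> n \<in> V} \<in> sets S"
    and K: "\<And>\<omega> n. n0 \<le> n \<Longrightarrow> orbit w x \<omega> n \<in> K"
    and c: "0 < c" "c \<le> 1"
    and hit: "\<And>y. y \<in> K \<Longrightarrow> c \<le> measure S {\<omega>. \<exists>n<L. orbit w y \<omega> n \<in> V}"
    and sp: "space M = UNIV"
  shows "AE \<omega> in S. \<forall>k. \<exists>n\<ge>k. orbit w x \<omega> n \<in> V"
proof -
  have spS: "space S = UNIV" by (simp add: space_PiM sp PiE_UNIV_domain)
  have E_sets: "{\<omega>. \<exists>n\<in>I. orbit w y \<omega> n \<in> V} \<in> sets S" for y and I :: "nat set"
  proof -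
    have "{\<omega>. \<exists>n\<in>I. orbit w y \<omega> n \<in> V} = (\<Union>n\<in>I. {\<omega>. orbit w y \<omega> n \<in> V})" by auto
    also have "\<dots> \<in> sets S" using meas by (intro sets.countable_UN') auto
    finally show ?thesis .
  qed
  define G where "G k t = {\<omega>. \<forall>n\<in>{k..<t}. orbit w x \<omega> n \<notin> V}" for k t
  have G_sets: "G k t \<in> sets S" for k t
  proof -
    have "G k t = space S - {\<omega>. \<exists>n\<in>{k..<t}. orbit w x \<omega> n \<in> V}" by (auto simp: G_def spS)
    then show ?thesis using E_sets by simp
  qed
  have step: "emeasure S (G k (t + L)) \<le> ennreal (1 - c) * emeasure S (G k t)"
    if "n0 \<le> k" "k \<le> t" for k t
  proof -
    let ?H = "\<lambda>y. {\<omega>. \<exists>n<L. orbit w y \<omega> n \<in> V}"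
    have comb: "(\<lambda>(\<omega>, \<omega>'). comb_seq t \<omega> \<omega>') \<in> measurable (S \<Otimes>\<^sub>M S) S"
      by (rule measurable_comb_seq)
    let ?Q = "(\<lambda>(\<omega>, \<omega>'). comb_seq t \<omega> \<omega>') -` G k (t + L) \<inter> space (S \<Otimes>\<^sub>M S)"
    have Q: "?Q \<in> sets (S \<Otimes>\<^sub>M S)" using comb G_sets by (rule measurable_sets)
    \<comment> \<open>For a fixed past \<open>\<omega>\<close> the section is empty unless \<open>\<omega>\<close> has avoided \<open>V\<close> up to time \<open>t\<close>;
      otherwise the future must avoid \<open>V\<close> when started at the point reached.\<close>
    have sect: "emeasure S (Pair \<omega> -` ?Q) \<le> ennreal (1 - c) * indicator (G k t) \<omega>" for \<omega>
    proof -
      have hH: "?H y \<in> sets S" for y using E_sets[of "{..<L}" y] by (simp add: Bex_def)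
      have sub: "Pair \<omega> -` ?Q \<subseteq> (if \<omega> \<in> G k t then space S - ?H (orbit w x \<omega> t) else {})"
      proof
        fix \<omega>' assume "\<omega>' \<in> Pair \<omega> -` ?Q"
        then have avoid: "orbit w x (comb_seq t \<omega> \<omega>') n \<notin> V" if "k \<le> n" "n < t + L" for n
          using that by (auto simp: G_def)
        have "\<omega> \<in> G k t"
          using avoid by (auto simp: G_def orbit_comb_seq_le) (metis orbit_comb_seq_le less_imp_le trans_less_add1)
        moreover have "orbit w (orbit w x \<omega> t) \<omega>' m \<notin> V" if "m < L" for m
          using avoid[of "t + m"] that \<open>k \<le> t\<close> by (simp add: orbit_comb_seq_add)
        ultimately show "\<omega>' \<in> (if \<omega> \<in> G k t then space S - ?H (orbit w x \<omega> t) else {})"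
          by (auto simp: spS)
      qed
      have "emeasure S (Pair \<omega> -` ?Q) \<le>
          emeasure S (if \<omega> \<in> G k t then space S - ?H (orbit w x \<omega> t) else {})"
        by (rule emeasure_mono[OF sub]) (use hH in auto)
      also have "\<dots> \<le> ennreal (1 - c) * indicator (G k t) \<omega>"
      proof (cases "\<omega> \<in> G k t")
        case True
        have "orbit w x \<omega> t \<in> K" using K that by simp
        then have "measure S (space S - ?H (orbit w x \<omega> t)) \<le> 1 - c"
          using hit by (simp only: P.prob_compl[OF hH]) fastforce
        then show ?thesis using True by (simp add: P.emeasure_eq_measure ennreal_leI)
      qed auto
      finally show ?thesis .
    qed
    have "emeasure S (G k (t + L)) = emeasure (distr (S \<Otimes>\<^sub>M S) S (\<lambda>(\<omega>, \<omega>'). comb_seq t \<omega> \<omega>')) (G k (t + L))"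
      by (simp only: PiM_comb_seq)
    also have "\<dots> = emeasure (S \<Otimes>\<^sub>M S) ?Q" by (rule emeasure_distr[OF comb G_sets])
    also have "\<dots> = (\<integral>\<^sup>+\<omega>. emeasure S (Pair \<omega> -` ?Q) \<partial>S)"
      by (rule P.emeasure_pair_measure_alt[OF Q])
    also have "\<dots> \<le> (\<integral>\<^sup>+\<omega>. ennreal (1 - c) * indicator (G k t) \<omega> \<partial>S)"
      by (intro nn_integral_mono sect)
    also have "\<dots> = ennreal (1 - c) * emeasure S (G k t)"
      using G_sets by (simp add: nn_integral_cmult)
    finally show ?thesis .
  qed
  have bound: "measure S (G k (k + j * L)) \<le> (1 - c) ^ j" if "n0 \<le> k" for k j
  proof (induction j)
    case 0
    show ?case by simp
  next
    case (Suc j)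
    have "measure S (G k (k + Suc j * L)) \<le> (1 - c) * measure S (G k (k + j * L))"
      using step[OF that, of "k + j * L"] c
      by (simp add: P.emeasure_eq_measure ennreal_mult[symmetric] ac_simps)
    also have "\<dots> \<le> (1 - c) * (1 - c) ^ j" using Suc c by (intro mult_left_mono) auto
    finally show ?case by simp
  qed
  have null: "AE \<omega> in S. \<exists>n\<ge>k. orbit w x \<omega> n \<in> V" if "n0 \<le> k" for k
  proof -
    define Z where "Z = space S - {\<omega>. \<exists>n\<in>{k..}. orbit w x \<omega> n \<in> V}"
    have Z: "Z \<in> sets S" using E_sets by (auto simp: Z_def)
    have "measure S Z \<le> (1 - c) ^ j" for j
    proof -
      have "measure S Z \<le> measure S (G k (k + j * L))"
        using G_sets by (intro P.finite_measure_mono) (auto simp: Z_def G_def)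
      then show ?thesis using bound[OF that, of j] by linarith
    qed
    moreover have "(\<lambda>j. (1 - c) ^ j) \<longlonglongrightarrow> 0" using c by (intro LIMSEQ_power_zero) auto
    ultimately have "measure S Z \<le> 0" by (intro LIMSEQ_le_const) auto
    then have "emeasure S Z = 0" by (simp add: P.emeasure_eq_measure measure_le_0_iff)
    then show ?thesis
      by (intro AE_I[OF _ _ Z]) (auto simp: Z_def)
  qed
  have "AE \<omega> in S. \<forall>k. \<exists>n\<ge>max k n0. orbit w x \<omega> n \<in> V"
    unfolding AE_all_countable by (intro allI null) simp
  then show ?thesis by (rule AE_mp) (auto intro!: AE_I2)
qed

section \<open>Random orbits draw the attractor\<close>

theorem theorem6p4:
  fixes w :: "'l::metric_space \<Rightarrow> 'x::complete_space \<Rightarrow> 'x"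
    and p :: "'l measure"
    and A U :: "'x set"
    and x :: 'x
  assumes "proper_space TYPE('x)"
    and "compact (UNIV :: 'l set)"
    and "ifs w"
    and "sets p = sets borel" and "prob_space p" and "fair_measure p"
    and "attractor_with_basin w A U"
    and "x \<in> U"
  shows "measure (\<Pi>\<^sub>M k\<in>(UNIV :: nat set). p) (drawing_sequences w A x) = 1"
proof -
  interpret prob_space p by fact
  interpret sequence_space p by unfold_locales
  have sp: "space p = UNIV" using sets_eq_imp_space_eq[OF assms(4)] by simp
  have spS: "space S = UNIV" by (simp add: space_PiM sp PiE_UNIV_domain)
  have A: "compact A" using assms(7) by (auto simp: attractor_with_basin_def nonempty_compacts_def)
  have conv: "\<forall>\<^sub>F n in sequentially. \<forall>\<omega>. infdist (orbit w x \<omega> n) A \<le> e" if "0 < e" for e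
    using basin_hausdorff[OF assms(7,8) that] by (rule eventually_mono) auto
  have "\<exists>N. finite N \<and> N \<subseteq> A \<and> A \<subseteq> (\<Union>a\<in>N. ball a (1 / real (Suc m)))" for m
  proof -
    have "\<forall>e>0. \<exists>N. finite N \<and> N \<subseteq> A \<and> A \<subseteq> (\<Union>a\<in>N. ball a e)"
      using A seq_compact_imp_totally_bounded compact_imp_seq_compact by blast
    then show ?thesis by simp
  qed
  then obtain N where N: "\<And>m. finite (N m)" "\<And>m. N m \<subseteq> A"
    "\<And>m. A \<subseteq> (\<Union>a\<in>N m. ball a (1 / real (Suc m)))"
    by metis
  obtain r where r: "0 < r" "compact {y. infdist y A \<le> r}" "{y. infdist y A \<le> r} \<subseteq> U"
    using attractor_compact_neighbourhood[OF assms(1,7)] by metis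
  obtain n0 where n0: "\<And>n \<omega>. n0 \<le> n \<Longrightarrow> orbit w x \<omega> n \<in> {y. infdist y A \<le> r}"
    using conv[OF r(1)] unfolding eventually_sequentially by auto
  have meas: "{\<omega>. orbit w y \<omega> n \<in> V} \<in> sets S" if "open V" for y n V
    using measurable_sets[OF continuous_imp_measurable_PiM[OF assms(2,4)
      continuous_orbit_sequence[OF assms(3), of y n]], of V] that
    by (simp add: vimage_def spS)
  have io: "AE \<omega> in S. \<forall>k. \<exists>n\<ge>k. orbit w x \<omega> n \<in> ball a e" if "a \<in> A" "0 < e" for a e
  proof -
    obtain c L where cL: "0 < c" "c \<le> 1"
      "\<And>y. y \<in> {y. infdist y A \<le> r} \<Longrightarrow> c \<le> measure S {\<omega>. \<exists>n<L. orbit w y \<omega> n \<in> ball a e}"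
    proof (rule uniform_hitting_bound[OF assms(2-6) r(2) open_ball])
      fix y assume "y \<in> {y. infdist y A \<le> r}"
      then have "y \<in> U" using r(3) by blast
      then show "\<exists>\<omega> n. orbit w y \<omega> n \<in> ball a e"
        by (rule basin_hits_ball[OF assms(7) _ \<open>a \<in> A\<close> \<open>0 < e\<close>]) blast
    qed blast
    show ?thesis
      by (rule AE_infinitely_often_hits[OF meas[OF open_ball] n0 cL sp])
  qed
  have "AE \<omega> in S. \<forall>m. \<forall>a\<in>N m. \<forall>k. \<exists>n\<ge>k. orbit w x \<omega> n \<in> ball a (1 / real (Suc m))"
    unfolding AE_all_countable
  proof
    fix m
    show "AE \<omega> in S. \<forall>a\<in>N m. \<forall>k. \<exists>n\<ge>k. orbit w x \<omega> n \<in> ball a (1 / real (Suc m))"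
      by (rule AE_finite_allI[OF N(1)], rule io) (use N(2) in auto)
  qed
  moreover have eq: "drawing_sequences w A x =
      {\<omega>. \<forall>m. \<forall>a\<in>N m. \<forall>k. \<exists>n\<ge>k. orbit w x \<omega> n \<in> ball a (1 / real (Suc m))}"
    by (rule drawing_sequences_eq[OF conv N(2,3)])
  moreover have "drawing_sequences w A x \<in> sets S"
  proof -
    have "{\<omega> \<in> space S. \<forall>m. \<forall>a\<in>N m. \<forall>k. \<exists>n. n \<ge> k \<and> orbit w x \<omega> n \<in> ball a (1 / real (Suc m))} \<in> sets S"
    proof (intro sets.sets_Collect_countable_All sets.sets_Collect_countable_All'
        sets.sets_Collect_countable_Ex sets.sets_Collect_conj sets.sets_Collect_const countable_finite N(1))
      show "{\<omega> \<in> space S. orbit w x \<omega> n \<in> ball a (1 / real (Suc m))} \<in> sets S" for n m a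
        using meas[OF open_ball, of x n a "1 / real (Suc m)"] by (simp add: spS del: mem_ball)
    qed
    then show ?thesis unfolding eq spS by simp
  qed
  ultimately show ?thesis
    by (subst P.prob_eq_1) auto
qed

end
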